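(* Let $(\Omega,\Sigma,\mu)$ be a positive, complete, $\sigma$-finite measure space, $(\Omega_\alpha)_{\alpha\in I}$ a countable measurable partition of $\Omega$, $X_\alpha$ ($\alpha\in I$) non-trivial quasi-normed ideal spaces over $(\Omega_\alpha,\Sigma_\alpha,\mu_\alpha)$ with moduli of concavity $C_\alpha$ satisfying $\sup_\alpha C_\alpha<\infty$, and $E$ a quasi-normed ideal space over the counting measure space $(I,2^I,m)$. Then the Köthe-Herz space $\left(E(\mathcal X),\|\cdot\|_{E(\mathcal X)}\right)$ is a quasi-normed ideal space over $(\Omega,\Sigma,\mu)$.
   Context: A quasi-norm satisfies $\|x\|=0$ iff $x=0$, $\|ax\|=|a|\|x\|$, and $\|x+y\|\le C(\|x\|+\|y\|)$ for some $C\ge1$; the smallest such $C$ is the modulus of concavity. A quasi-normed ideal space over $(\Omega,\Sigma,\mu)$ is a linear subspace $E$ of $L^0(\Omega,\Sigma,\mu)$ (classes of real measurable functions, ordered a.e.) with a quasi-norm such that (i) if $f\in L^0$, $g\in E$, $|f|\le|g|$ a.e., then $f\in E$ and $\|f\|_E\le\|g\|_E$; (ii) there is $f\in E$ strictly positive on the whole of $\Omega$. Measurable partition: $\Omega_\alpha\in\Sigma$, $\Omega=\bigcup_{\alpha\in I}\Omega_\alpha$ $\mu$-a.e., $\mu(\Omega_\alpha\cap\Omega_\beta)=0$ for $\alpha\ne\beta$; $\Sigma_\alpha=\{\Omega_\alpha\cap B:B\in\Sigma\}$, $\mu_\alpha=\mu|_{\Sigma_\alpha}$. Köthe-Herz space: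 $E(\mathcal X)=\{f\in L^0(\Omega,\Sigma,\mu): f\chi_{\Omega_\alpha}\in X_\alpha\text{ for each }\alpha\in I\text{ and }(\|f\chi_{\Omega_\alpha}\|_{X_\alpha})_\alpha\in E\}$, with $\|f\|_{E(\mathcal X)}=\left\|(\|f\chi_{\Omega_\alpha}\|_{X_\alpha})_\alpha\right\|_E$, where $\mathcal X=(X_\alpha)_{\alpha\in I}$. *)

theory Defs
  imports "HOL-Analysis.Analysis"
begin

(* An element of L^0(M) is an honest equivalence class of real measurable functions modulo
   equality almost everywhere. Functions are total on the type 'a; their values outside
   space M are irrelevant, and functions that differ only there lie in the same class. *)

type_synonym 'a l0 = "('a \<Rightarrow> real) set"

definition ae_eq :: "'a measure \<Rightarrow> (('a \<Rightarrow> real) \<times> ('a \<Rightarrow> real)) set" where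
  "ae_eq M = {(f, g). f \<in> borel_measurable M \<and> g \<in> borel_measurable M \<and> (AE x in M. f x = g x)}"

definition L0 :: "'a measure \<Rightarrow> 'a l0 set" where
  "L0 M = borel_measurable M // ae_eq M"

definition l0_class :: "'a measure \<Rightarrow> ('a \<Rightarrow> real) \<Rightarrow> 'a l0" where
  "l0_class M f = ae_eq M `` {f}"

definition l0_zero :: "'a measure \<Rightarrow> 'a l0" where
  "l0_zero M = l0_class M (\<lambda>x. 0)"

definition l0_add :: "'a measure \<Rightarrow> 'a l0 \<Rightarrow> 'a l0 \<Rightarrow> 'a l0" where
  "l0_add M u v = (\<Union>f\<in>u. \<Union>g\<in>v. l0_class M (\<lambda>x. f x + g x))"

definition l0_scale :: "'a measure \<Rightarrow> real \<Rightarrow> 'a l0 \<Rightarrow> 'a l0" where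
  "l0_scale M a u = (\<Union>f\<in>u. l0_class M (\<lambda>x. a * f x))"

definition l0_abs_le :: "'a measure \<Rightarrow> 'a l0 \<Rightarrow> 'a l0 \<Rightarrow> bool" where
  "l0_abs_le M u v \<longleftrightarrow> (\<exists>f\<in>u. \<exists>g\<in>v. AE x in M. \<bar>f x\<bar> \<le> \<bar>g x\<bar>)"

(* The class of f * indicator A, regarded as an element of L^0 over the subspace A. *)

definition l0_restrict :: "'a measure \<Rightarrow> 'a set \<Rightarrow> 'a l0 \<Rightarrow> 'a l0" where
  "l0_restrict M A u = (\<Union>f\<in>u. l0_class (restrict_space M A) (\<lambda>x. f x * indicator A x))"

lemma equiv_ae_eq: "equiv (borel_measurable M) (ae_eq M)"
  by (rule equivI) (auto simp: ae_eq_def intro!: refl_onI symI transI elim: AE_mp)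

lemma l0_class_in_L0: "f \<in> borel_measurable M \<Longrightarrow> l0_class M f \<in> L0 M"
  by (auto simp: L0_def l0_class_def intro: quotientI)

lemma L0_cases:
  assumes "u \<in> L0 M"
  obtains f where "f \<in> borel_measurable M" "u = l0_class M f"
  using assms by (auto simp: L0_def l0_class_def elim: quotientE)

lemma mem_l0_class_iff:
  "g \<in> l0_class M f \<longleftrightarrow>
    f \<in> borel_measurable M \<and> g \<in> borel_measurable M \<and> (AE x in M. f x = g x)"
  by (auto simp: l0_class_def ae_eq_def)

lemma l0_class_eq_iff:
  assumes "f \<in> borel_measurable M" "g \<in> borel_measurable M"
  shows "l0_class M f = l0_class M g \<longleftrightarrow> (AE x in M. f x = g x)"
  using eq_equiv_class_iff[OF equiv_ae_eq assms] assms
  by (auto simp: l0_class_def ae_eq_def)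

(* The operations on classes agree with the pointwise ones on representatives. *)

lemma UN_l0_class_eq:
  assumes "\<And>f. f \<in> u \<Longrightarrow> l0_class M (F f) = c" "u \<noteq> {}"
  shows "(\<Union>f\<in>u. l0_class M (F f)) = c"
  using assms by auto

lemma l0_class_nonempty: "f \<in> borel_measurable M \<Longrightarrow> l0_class M f \<noteq> {}"
  using mem_l0_class_iff[of f M f] by auto

lemma l0_scale_class:
  assumes "f \<in> borel_measurable M"
  shows "l0_scale M a (l0_class M f) = l0_class M (\<lambda>x. a * f x)"
  unfolding l0_scale_def
proof (rule UN_l0_class_eq)
  fix g assume g: "g \<in> l0_class M f"
  then have [measurable]: "g \<in> borel_measurable M" "f \<in> borel_measurable M"
    by (auto simp: mem_l0_class_iff)
  have "AE x in M. f x = g x" using g by (auto simp: mem_l0_class_iff)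
  then have "AE x in M. a * g x = a * f x" by eventually_elim simp
  then show "l0_class M (\<lambda>x. a * g x) = l0_class M (\<lambda>x. a * f x)"
    by (subst l0_class_eq_iff) auto
qed (rule l0_class_nonempty[OF assms])

lemma l0_add_class:
  assumes "f \<in> borel_measurable M" "g \<in> borel_measurable M"
  shows "l0_add M (l0_class M f) (l0_class M g) = l0_class M (\<lambda>x. f x + g x)"
proof -
  have "l0_class M (\<lambda>x. f' x + g' x) = l0_class M (\<lambda>x. f x + g x)"
    if f': "f' \<in> l0_class M f" and g': "g' \<in> l0_class M g" for f' g'
  proof -
    have [measurable]: "f \<in> borel_measurable M" "f' \<in> borel_measurable M"
      "g \<in> borel_measurable M" "g' \<in> borel_measurable M"
      using f' g' by (auto simp: mem_l0_class_iff)
    have "AE x in M. f x = f' x" "AE x in M. g x = g' x"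
      using f' g' by (auto simp: mem_l0_class_iff)
    then have "AE x in M. f' x + g' x = f x + g x" by eventually_elim simp
    then show ?thesis by (subst l0_class_eq_iff) auto
  qed
  then show ?thesis
    unfolding l0_add_def using assms[THEN l0_class_nonempty] by auto
qed

lemma l0_abs_le_class:
  assumes "f \<in> borel_measurable M" "g \<in> borel_measurable M"
  shows "l0_abs_le M (l0_class M f) (l0_class M g) \<longleftrightarrow> (AE x in M. \<bar>f x\<bar> \<le> \<bar>g x\<bar>)"
proof
  assume "l0_abs_le M (l0_class M f) (l0_class M g)"
  then obtain f' g' where "AE x in M. f x = f' x" "AE x in M. g x = g' x"
    "AE x in M. \<bar>f' x\<bar> \<le> \<bar>g' x\<bar>"
    by (auto simp: l0_abs_le_def mem_l0_class_iff)
  then show "AE x in M. \<bar>f x\<bar> \<le> \<bar>g x\<bar>" by eventually_elim simp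
next
  assume "AE x in M. \<bar>f x\<bar> \<le> \<bar>g x\<bar>"
  moreover have "f \<in> l0_class M f" "g \<in> l0_class M g" using assms by (auto simp: mem_l0_class_iff)
  ultimately show "l0_abs_le M (l0_class M f) (l0_class M g)"
    unfolding l0_abs_le_def by blast
qed

lemma l0_restrict_class:
  assumes "f \<in> borel_measurable M" "A \<in> sets M"
  shows "l0_restrict M A (l0_class M f) = l0_class (restrict_space M A) (\<lambda>x. f x * indicator A x)"
  unfolding l0_restrict_def
proof (rule UN_l0_class_eq)
  fix g assume g: "g \<in> l0_class M f"
  note [measurable] = assms(2)
  have [measurable]: "g \<in> borel_measurable M" "f \<in> borel_measurable M"
    using g by (auto simp: mem_l0_class_iff)
  have *: "(\<lambda>x. g x * indicator A x) \<in> borel_measurable (restrict_space M A)"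
    "(\<lambda>x. f x * indicator A x) \<in> borel_measurable (restrict_space M A)"
    by (rule measurable_restrict_space1; measurable)+
  have "AE x in M. f x = g x" using g by (auto simp: mem_l0_class_iff)
  then have "AE x in M. x \<in> A \<longrightarrow> g x * indicator A x = f x * indicator A x"
    by eventually_elim simp
  then have "AE x in restrict_space M A. g x * indicator A x = f x * indicator A x"
    using assms(2) by (subst AE_restrict_space_iff) auto
  with * show "l0_class (restrict_space M A) (\<lambda>x. g x * indicator A x) =
      l0_class (restrict_space M A) (\<lambda>x. f x * indicator A x)"
    by (simp add: l0_class_eq_iff)
qed (rule l0_class_nonempty[OF assms(1)])

definition l0_subspace :: "'a measure \<Rightarrow> 'a l0 set \<Rightarrow> bool" where
  "l0_subspace M E \<longleftrightarrow> E \<subseteq> L0 M \<and> l0_zero M \<in> E \<and>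
    (\<forall>u\<in>E. \<forall>v\<in>E. l0_add M u v \<in> E) \<and> (\<forall>a. \<forall>u\<in>E. l0_scale M a u \<in> E)"

definition concavity_const :: "'a measure \<Rightarrow> 'a l0 set \<Rightarrow> ('a l0 \<Rightarrow> real) \<Rightarrow> real \<Rightarrow> bool" where
  "concavity_const M E N C \<longleftrightarrow>
    1 \<le> C \<and> (\<forall>u\<in>E. \<forall>v\<in>E. N (l0_add M u v) \<le> C * (N u + N v))"

definition quasi_norm :: "'a measure \<Rightarrow> 'a l0 set \<Rightarrow> ('a l0 \<Rightarrow> real) \<Rightarrow> bool" where
  "quasi_norm M E N \<longleftrightarrow>
    (\<forall>u\<in>E. 0 \<le> N u) \<and>
    (\<forall>u\<in>E. N u = 0 \<longleftrightarrow> u = l0_zero M) \<and>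
    (\<forall>a. \<forall>u\<in>E. N (l0_scale M a u) = \<bar>a\<bar> * N u) \<and>
    (\<exists>C. concavity_const M E N C)"

definition modulus_of_concavity :: "'a measure \<Rightarrow> 'a l0 set \<Rightarrow> ('a l0 \<Rightarrow> real) \<Rightarrow> real" where
  "modulus_of_concavity M E N = (LEAST C. concavity_const M E N C)"

definition quasi_normed_ideal_space :: "'a measure \<Rightarrow> 'a l0 set \<Rightarrow> ('a l0 \<Rightarrow> real) \<Rightarrow> bool" where
  "quasi_normed_ideal_space M E N \<longleftrightarrow>
    l0_subspace M E \<and> quasi_norm M E N \<and>
    (\<forall>u\<in>L0 M. \<forall>v\<in>E. l0_abs_le M u v \<longrightarrow> u \<in> E \<and> N u \<le> N v) \<and>
    (\<exists>u\<in>E. \<exists>f\<in>u. \<forall>x\<in>space M. 0 < f x)"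

(* LEAST is a definite description, so check that the smallest constant exists. *)

lemma concavity_const_modulus:
  assumes "quasi_norm M E N"
  shows "concavity_const M E N (modulus_of_concavity M E N)"
    and "concavity_const M E N C \<Longrightarrow> modulus_of_concavity M E N \<le> C"
proof -
  let ?S = "{C. concavity_const M E N C}"
  have ne: "?S \<noteq> {}" using assms by (auto simp: quasi_norm_def)
  have bdd: "bdd_below ?S" by (rule bdd_belowI[of _ 1]) (auto simp: concavity_const_def)
  have S_eq: "?S = {1..} \<inter> (\<Inter>u\<in>E. \<Inter>v\<in>E. {C. N (l0_add M u v) \<le> C * (N u + N v)})"
    by (auto simp: concavity_const_def)
  have "closed ?S"
    unfolding S_eq by (intro closed_Int closed_INT ballI closed_Collect_le closed_atLeast continuous_intros)
  then have min: "concavity_const M E N (Inf ?S)"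
    using closed_contains_Inf[OF ne bdd] by simp
  have le: "Inf ?S \<le> C" if "concavity_const M E N C" for C
    using that by (intro cInf_lower bdd) simp
  have eq: "modulus_of_concavity M E N = Inf ?S"
    unfolding modulus_of_concavity_def using min le by (rule Least_equality)
  show "concavity_const M E N (modulus_of_concavity M E N)" using min eq by simp
  show "modulus_of_concavity M E N \<le> C" if "concavity_const M E N C" using le[OF that] eq by simp
qed

definition countable_measurable_partition :: "'a measure \<Rightarrow> 'i set \<Rightarrow> ('i \<Rightarrow> 'a set) \<Rightarrow> bool" where
  "countable_measurable_partition M I A \<longleftrightarrow>
    countable I \<and> (\<forall>\<alpha>\<in>I. A \<alpha> \<in> sets M) \<and> (AE x in M. x \<in> (\<Union>\<alpha>\<in>I. A \<alpha>)) \<and>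
    (\<forall>\<alpha>\<in>I. \<forall>\<beta>\<in>I. \<alpha> \<noteq> \<beta> \<longrightarrow> emeasure M (A \<alpha> \<inter> A \<beta>) = 0)"

definition norm_family ::
  "'a measure \<Rightarrow> 'i set \<Rightarrow> ('i \<Rightarrow> 'a set) \<Rightarrow> ('i \<Rightarrow> 'a l0 \<Rightarrow> real) \<Rightarrow> 'a l0 \<Rightarrow> 'i l0" where
  "norm_family M I A nX u = l0_class (count_space I) (\<lambda>\<alpha>. nX \<alpha> (l0_restrict M (A \<alpha>) u))"

definition koethe_herz_space ::
  "'a measure \<Rightarrow> 'i set \<Rightarrow> ('i \<Rightarrow> 'a set) \<Rightarrow> 'i l0 set \<Rightarrow>
    ('i \<Rightarrow> 'a l0 set) \<Rightarrow> ('i \<Rightarrow> 'a l0 \<Rightarrow> real) \<Rightarrow> 'a l0 set" where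
  "koethe_herz_space M I A E X nX =
    {u \<in> L0 M. (\<forall>\<alpha>\<in>I. l0_restrict M (A \<alpha>) u \<in> X \<alpha>) \<and> norm_family M I A nX u \<in> E}"

definition koethe_herz_norm ::
  "'a measure \<Rightarrow> 'i set \<Rightarrow> ('i \<Rightarrow> 'a set) \<Rightarrow> ('i l0 \<Rightarrow> real) \<Rightarrow>
    ('i \<Rightarrow> 'a l0 \<Rightarrow> real) \<Rightarrow> 'a l0 \<Rightarrow> real" where
  "koethe_herz_norm M I A nE nX u = nE (norm_family M I A nX u)"

end

theory Submission
  imports Defs
begin

text \<open>
  Restricting to a piece of the partition is linear and monotone on classes, so every requirement
  on the Koethe-Herz space first becomes a statement about the families
  \<open>\<alpha> \<mapsto> \<parallel>u \<chi>\<^sub>\<alpha>\<parallel>\<close> over \<open>I\<close>. The ideal property of \<open>E\<close>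
  finishes it there: a family dominated pointwise by one whose class lies in \<open>E\<close>
  has its own class in \<open>E\<close>, with a smaller norm (\<open>E_dominated\<close>).

  For sums, a common bound \<open>C\<close> on the moduli of concavity gives
  \<open>\<parallel>(u + v) \<chi>\<^sub>\<alpha>\<parallel> \<le> C (\<parallel>u \<chi>\<^sub>\<alpha>\<parallel> + \<parallel>v \<chi>\<^sub>\<alpha>\<parallel>)\<close> with the same \<open>C\<close> for all
  \<open>\<alpha>\<close>, so the family of \<open>u + v\<close> is dominated by a scalar multiple of a sum of two elements of
  \<open>E\<close>; the product of \<open>C\<close> and a concavity constant of \<open>E\<close> works for the whole space
  (\<open>koethe_herz_add\<close>). Definiteness uses countability of \<open>I\<close>: a class that vanishes on
  every piece vanishes off countably many null sets (\<open>eq_zero_if_restrict_zero\<close>).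

  A strictly positive element is glued from strictly positive \<open>f\<^sub>\<alpha>\<close> in \<open>X\<^sub>\<alpha>\<close> and
  \<open>e\<close> in \<open>E\<close>: on the piece of index \<open>\<alpha>\<close> take
  \<open>e\<^sub>\<alpha> f\<^sub>\<alpha> / (\<parallel>f\<^sub>\<alpha>\<parallel> + 1)\<close>, whose norm is at most \<open>e\<^sub>\<alpha>\<close>. The pieces
  may overlap in null sets and may miss a null set, so the gluing picks at each point the first
  piece containing it, and the value \<open>1\<close> where there is none
  (\<open>measurable_gluing\<close>, \<open>koethe_herz_positive\<close>).
\<close>

section \<open>Restriction of classes\<close>

lemma L0_memD:
  assumes "u \<in> L0 M" "f \<in> u"
  shows "f \<in> borel_measurable M" "u = l0_class M f"
proof -
  obtain g where g: "g \<in> borel_measurable M" "u = l0_class M g"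
    using assms(1) by (rule L0_cases)
  with assms(2) show "f \<in> borel_measurable M" "u = l0_class M f"
    by (auto simp: mem_l0_class_iff l0_class_eq_iff)
qed

lemma borel_measurable_restrict_indicator:
  fixes f :: "'a \<Rightarrow> real"
  assumes [measurable]: "f \<in> borel_measurable M" "S \<in> sets M"
  shows "(\<lambda>x. f x * indicator S x) \<in> borel_measurable (restrict_space M S)"
  by (rule measurable_restrict_space1) measurable

lemma l0_restrict_add:
  assumes "u \<in> L0 M" "v \<in> L0 M" and S [measurable]: "S \<in> sets M"
  shows "l0_restrict M S (l0_add M u v) =
    l0_add (restrict_space M S) (l0_restrict M S u) (l0_restrict M S v)"
proof -
  obtain f g where [measurable]: "f \<in> borel_measurable M" "g \<in> borel_measurable M"
    and uv: "u = l0_class M f" "v = l0_class M g"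
    using assms(1,2) by (metis L0_cases)
  show ?thesis
    by (simp add: uv l0_add_class l0_restrict_class borel_measurable_restrict_indicator
        distrib_right)
qed

lemma l0_restrict_scale:
  assumes "u \<in> L0 M" and S: "S \<in> sets M"
  shows "l0_restrict M S (l0_scale M a u) = l0_scale (restrict_space M S) a (l0_restrict M S u)"
proof -
  obtain f where [measurable]: "f \<in> borel_measurable M" and u: "u = l0_class M f"
    using assms(1) by (rule L0_cases)
  show ?thesis
    by (simp add: u S l0_scale_class l0_restrict_class borel_measurable_restrict_indicator
        mult.assoc)
qed

lemma l0_restrict_zero:
  assumes "S \<in> sets M"
  shows "l0_restrict M S (l0_zero M) = l0_zero (restrict_space M S)"
  by (simp add: l0_zero_def l0_restrict_class assms)

lemma l0_restrict_in_L0: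
  assumes "u \<in> L0 M" "S \<in> sets M"
  shows "l0_restrict M S u \<in> L0 (restrict_space M S)"
  using assms
  by (elim L0_cases)
    (simp add: l0_restrict_class l0_class_in_L0 borel_measurable_restrict_indicator)

lemma l0_restrict_abs_le:
  assumes "u \<in> L0 M" "v \<in> L0 M" and S: "S \<in> sets M" and le: "l0_abs_le M u v"
  shows "l0_abs_le (restrict_space M S) (l0_restrict M S u) (l0_restrict M S v)"
proof -
  obtain f g where [measurable]: "f \<in> borel_measurable M" "g \<in> borel_measurable M"
    and uv: "u = l0_class M f" "v = l0_class M g"
    using assms(1,2) by (metis L0_cases)
  have "AE x in M. \<bar>f x\<bar> \<le> \<bar>g x\<bar>"
    using le by (simp add: uv l0_abs_le_class)
  then have "AE x in restrict_space M S. \<bar>f x * indicator S x\<bar> \<le> \<bar>g x * indicator S x\<bar>"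
    using S by (subst AE_restrict_space_iff) (auto simp: indicator_def)
  then show ?thesis
    by (simp add: uv S l0_restrict_class l0_abs_le_class borel_measurable_restrict_indicator)
qed

lemma L0_add: "u \<in> L0 M \<Longrightarrow> v \<in> L0 M \<Longrightarrow> l0_add M u v \<in> L0 M"
  by (elim L0_cases) (simp add: l0_add_class l0_class_in_L0)

lemma L0_scale: "u \<in> L0 M \<Longrightarrow> l0_scale M a u \<in> L0 M"
  by (elim L0_cases) (simp add: l0_scale_class l0_class_in_L0)

lemma L0_zero: "l0_zero M \<in> L0 M"
  by (simp add: l0_zero_def l0_class_in_L0)

section \<open>Countable measurable partitions\<close>

lemma eq_zero_if_restrict_zero:
  assumes part: "countable_measurable_partition M I A"
    and u: "u \<in> L0 M"
    and zero: "\<And>\<alpha>. \<alpha> \<in> I \<Longrightarrow> l0_restrict M (A \<alpha>) u = l0_zero (restrict_space M (A \<alpha>))"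
  shows "u = l0_zero M"
proof -
  have A: "countable I" "\<And>\<alpha>. \<alpha> \<in> I \<Longrightarrow> A \<alpha> \<in> sets M" "AE x in M. x \<in> (\<Union>\<alpha>\<in>I. A \<alpha>)"
    using part by (auto simp: countable_measurable_partition_def)
  obtain f where f: "f \<in> borel_measurable M" and u_eq: "u = l0_class M f"
    using u by (rule L0_cases)
  have "AE x in M. x \<in> A \<alpha> \<longrightarrow> f x = 0" if \<alpha>: "\<alpha> \<in> I" for \<alpha>
  proof -
    have "AE x in restrict_space M (A \<alpha>). f x * indicator (A \<alpha>) x = 0"
      using zero[OF \<alpha>] A(2)[OF \<alpha>] f
      by (simp add: u_eq l0_restrict_class l0_zero_def l0_class_eq_iff
          borel_measurable_restrict_indicator)
    then show ?thesis
      using A(2)[OF \<alpha>] by (subst (asm) AE_restrict_space_iff) auto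
  qed
  then have "AE x in M. \<forall>\<alpha>\<in>I. x \<in> A \<alpha> \<longrightarrow> f x = 0"
    by (subst AE_ball_countable[OF A(1)]) blast
  with A(3) have "AE x in M. f x = 0"
    by eventually_elim auto
  then show ?thesis
    using f by (simp add: u_eq l0_zero_def l0_class_eq_iff)
qed

text \<open>
  The countable index set is ordered by \<^const>\<open>to_nat_on\<close>, and the glued function takes at
  each point the value prescribed by the first piece that contains the point. Since two distinct
  pieces meet in a null set, almost every point of a piece lies in no other one.
\<close>

lemma measurable_gluing:
  fixes g :: "'i \<Rightarrow> 'a \<Rightarrow> real"
  assumes part: "countable_measurable_partition M I A"
    and g: "\<And>\<alpha>. \<alpha> \<in> I \<Longrightarrow> g \<alpha> \<in> borel_measurable (restrict_space M (A \<alpha>))"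
    and pos: "\<And>\<alpha> x. \<alpha> \<in> I \<Longrightarrow> x \<in> A \<alpha> \<Longrightarrow> 0 < g \<alpha> x"
  obtains w where "w \<in> borel_measurable M" "\<And>x. 0 < w x"
    "\<And>\<alpha>. \<alpha> \<in> I \<Longrightarrow> AE x in M. x \<in> A \<alpha> \<longrightarrow> w x = g \<alpha> x"
proof -
  have I: "countable I" and A: "\<And>\<alpha>. \<alpha> \<in> I \<Longrightarrow> A \<alpha> \<in> sets M"
    and disj: "\<And>\<alpha> \<beta>. \<alpha> \<in> I \<Longrightarrow> \<beta> \<in> I \<Longrightarrow> \<alpha> \<noteq> \<beta> \<Longrightarrow> emeasure M (A \<alpha> \<inter> A \<beta>) = 0"
    using part by (auto simp: countable_measurable_partition_def)
  define J where "J = to_nat_on I ` I"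
  define i where "i = from_nat_into I"
  have i: "i n \<in> I" if "n \<in> J" for n
    using that I by (auto simp: J_def i_def)
  define P where "P = (\<lambda>n x. n \<in> J \<and> x \<in> A (i n))"
  define h where "h = (\<lambda>n x. if P n x then g (i n) x else 1)"
  \<comment> \<open>Where no piece contains \<open>x\<close>, the least index is an unspecified number, but
    every \<open>h n x\<close> is then \<open>1\<close>.\<close>
  define w where "w = (\<lambda>x. h (LEAST n. P n x) x)"
  have P_meas: "Measurable.pred M (P n)" for n
  proof (cases "n \<in> J")
    case True
    with A[OF i] have [measurable]: "A (i n) \<in> sets M" by simp
    show ?thesis using True by (simp add: P_def)
  qed (simp add: P_def)
  have h_meas: "h n \<in> borel_measurable M" for n
  proof (cases "n \<in> J")
    case True
    have "(\<lambda>x. if x \<in> A (i n) then g (i n) x else 1) \<in> borel_measurable M"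
      using A[OF i[OF True]] g[OF i[OF True]]
      by (subst measurable_If_restrict_space_iff) auto
    then show ?thesis using True by (simp add: h_def P_def)
  qed (simp add: h_def P_def)
  have "w \<in> borel_measurable M"
    unfolding w_def
    by (rule measurable_compose_countable[OF h_meas measurable_Least[OF P_meas]])
  moreover have "0 < w x" for x
    using pos i by (simp add: w_def h_def P_def)
  moreover have "AE x in M. x \<in> A \<alpha> \<longrightarrow> w x = g \<alpha> x" if \<alpha>: "\<alpha> \<in> I" for \<alpha>
  proof -
    have "AE x in M. x \<notin> A \<alpha> \<inter> A \<beta>" if "\<beta> \<in> I" "\<beta> \<noteq> \<alpha>" for \<beta>
      using A[OF \<alpha>] A[OF that(1)] disj[OF \<alpha> that(1)] that(2)
      by (intro AE_not_in) (auto simp: null_sets_def)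
    then have "AE x in M. \<forall>\<beta>\<in>I. \<beta> \<noteq> \<alpha> \<longrightarrow> x \<notin> A \<alpha> \<inter> A \<beta>"
      using I by (subst AE_ball_countable) auto
    then show ?thesis
    proof eventually_elim
      case (elim x)
      show ?case
      proof
        assume x: "x \<in> A \<alpha>"
        have P_iff: "P n x \<longleftrightarrow> n = to_nat_on I \<alpha>" for n
          using elim x I \<alpha> i by (auto simp: P_def J_def i_def)
        have "(LEAST n. P n x) = to_nat_on I \<alpha>"
          unfolding P_iff by (rule Least_equality) auto
        then show "w x = g \<alpha> x"
          using \<alpha> I by (simp add: w_def h_def P_iff) (simp add: i_def)
      qed
    qed
  qed
  ultimately show thesis by (rule that)
qed

section \<open>The Koethe-Herz space\<close>

locale koethe_herz =
  fixes M :: "'a measure"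
    and I :: "'i set"
    and A :: "'i \<Rightarrow> 'a set"
    and X :: "'i \<Rightarrow> 'a l0 set"
    and nX :: "'i \<Rightarrow> 'a l0 \<Rightarrow> real"
    and E :: "'i l0 set"
    and nE :: "'i l0 \<Rightarrow> real"
  assumes part: "countable_measurable_partition M I A"
    and X_ideal: "\<And>\<alpha>. \<alpha> \<in> I \<Longrightarrow> quasi_normed_ideal_space (restrict_space M (A \<alpha>)) (X \<alpha>) (nX \<alpha>)"
    and bdd: "bdd_above ((\<lambda>\<alpha>. modulus_of_concavity (restrict_space M (A \<alpha>)) (X \<alpha>) (nX \<alpha>)) ` I)"
    and E_ideal: "quasi_normed_ideal_space (count_space I) E nE"
begin

abbreviation H where "H \<equiv> koethe_herz_space M I A E X nX"
abbreviation nH where "nH \<equiv> koethe_herz_norm M I A nE nX"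
abbreviation R where "R \<alpha> \<equiv> restrict_space M (A \<alpha>)"
abbreviation cls where "cls \<equiv> l0_class (count_space I)"
abbreviation piece_norm where "piece_norm u \<alpha> \<equiv> nX \<alpha> (l0_restrict M (A \<alpha>) u)"

lemma A_sets: "\<alpha> \<in> I \<Longrightarrow> A \<alpha> \<in> sets M"
  using part by (simp add: countable_measurable_partition_def)

lemma X_add: "\<alpha> \<in> I \<Longrightarrow> u \<in> X \<alpha> \<Longrightarrow> v \<in> X \<alpha> \<Longrightarrow> l0_add (R \<alpha>) u v \<in> X \<alpha>"
  and X_scale: "\<alpha> \<in> I \<Longrightarrow> u \<in> X \<alpha> \<Longrightarrow> l0_scale (R \<alpha>) a u \<in> X \<alpha>"
  and X_zero: "\<alpha> \<in> I \<Longrightarrow> l0_zero (R \<alpha>) \<in> X \<alpha>"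
  and X_L0: "\<alpha> \<in> I \<Longrightarrow> u \<in> X \<alpha> \<Longrightarrow> u \<in> L0 (R \<alpha>)"
  and nX_nonneg: "\<alpha> \<in> I \<Longrightarrow> u \<in> X \<alpha> \<Longrightarrow> 0 \<le> nX \<alpha> u"
  and nX_eq_0_iff: "\<alpha> \<in> I \<Longrightarrow> u \<in> X \<alpha> \<Longrightarrow> nX \<alpha> u = 0 \<longleftrightarrow> u = l0_zero (R \<alpha>)"
  and nX_scale: "\<alpha> \<in> I \<Longrightarrow> u \<in> X \<alpha> \<Longrightarrow> nX \<alpha> (l0_scale (R \<alpha>) a u) = \<bar>a\<bar> * nX \<alpha> u"
  and X_dominated: "\<alpha> \<in> I \<Longrightarrow> u \<in> L0 (R \<alpha>) \<Longrightarrow> v \<in> X \<alpha> \<Longrightarrow> l0_abs_le (R \<alpha>) u v \<Longrightarrow>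
    u \<in> X \<alpha> \<and> nX \<alpha> u \<le> nX \<alpha> v"
  using X_ideal[of \<alpha>]
  by (auto simp: quasi_normed_ideal_space_def l0_subspace_def quasi_norm_def)

lemma cls_eq_iff: "cls p = cls q \<longleftrightarrow> (\<forall>\<alpha>\<in>I. p \<alpha> = q \<alpha>)"
  by (simp add: l0_class_eq_iff AE_count_space)

lemma E_add: "cls p \<in> E \<Longrightarrow> cls q \<in> E \<Longrightarrow> cls (\<lambda>\<alpha>. p \<alpha> + q \<alpha>) \<in> E"
  and E_scale: "cls p \<in> E \<Longrightarrow> cls (\<lambda>\<alpha>. a * p \<alpha>) \<in> E"
  and nE_scale: "cls p \<in> E \<Longrightarrow> nE (cls (\<lambda>\<alpha>. a * p \<alpha>)) = \<bar>a\<bar> * nE (cls p)"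
  and nE_nonneg: "cls p \<in> E \<Longrightarrow> 0 \<le> nE (cls p)"
  and E_zero: "cls (\<lambda>\<alpha>. 0) \<in> E"
  and nE_eq_0_iff: "cls p \<in> E \<Longrightarrow> nE (cls p) = 0 \<longleftrightarrow> (\<forall>\<alpha>\<in>I. p \<alpha> = 0)"
  using E_ideal
  by (auto simp: quasi_normed_ideal_space_def l0_subspace_def quasi_norm_def l0_zero_def
      cls_eq_iff l0_add_class[of p "count_space I" q, symmetric]
      l0_scale_class[of p "count_space I" a, symmetric])

text \<open>
  The only null set of the counting measure on \<open>I\<close> is the empty one, so domination in \<open>E\<close> can
  be checked index by index.
\<close>

lemma E_dominated:
  assumes "cls q \<in> E" "\<And>\<alpha>. \<alpha> \<in> I \<Longrightarrow> \<bar>p \<alpha>\<bar> \<le> \<bar>q \<alpha>\<bar>"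
  shows "cls p \<in> E" "nE (cls p) \<le> nE (cls q)"
proof -
  have "l0_abs_le (count_space I) (cls p) (cls q)"
    using assms(2) by (simp add: l0_abs_le_class AE_count_space)
  moreover have "cls p \<in> L0 (count_space I)"
    by (simp add: l0_class_in_L0)
  ultimately show "cls p \<in> E" "nE (cls p) \<le> nE (cls q)"
    using assms(1) E_ideal unfolding quasi_normed_ideal_space_def by blast+
qed

lemma mem_H_iff:
  "u \<in> H \<longleftrightarrow> u \<in> L0 M \<and> (\<forall>\<alpha>\<in>I. l0_restrict M (A \<alpha>) u \<in> X \<alpha>) \<and> cls (piece_norm u) \<in> E"
  by (simp add: koethe_herz_space_def norm_family_def)

lemma nH_eq: "nH u = nE (cls (piece_norm u))"
  by (simp add: koethe_herz_norm_def norm_family_def)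

lemma uniform_concavity:
  obtains C where "1 \<le> C"
    "\<And>\<alpha> u v. \<alpha> \<in> I \<Longrightarrow> u \<in> X \<alpha> \<Longrightarrow> v \<in> X \<alpha> \<Longrightarrow>
      nX \<alpha> (l0_add (R \<alpha>) u v) \<le> C * (nX \<alpha> u + nX \<alpha> v)"
proof -
  obtain B where B: "\<And>\<alpha>. \<alpha> \<in> I \<Longrightarrow> modulus_of_concavity (R \<alpha>) (X \<alpha>) (nX \<alpha>) \<le> B"
    using bdd by (auto simp: bdd_above_def)
  \<comment> \<open>If \<open>I\<close> is empty, \<open>B\<close> is arbitrary; the maximum makes it a concavity constant.\<close>
  have "nX \<alpha> (l0_add (R \<alpha>) u v) \<le> max 1 B * (nX \<alpha> u + nX \<alpha> v)"
    if \<alpha>: "\<alpha> \<in> I" and uv: "u \<in> X \<alpha>" "v \<in> X \<alpha>" for \<alpha> u v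
  proof -
    have "quasi_norm (R \<alpha>) (X \<alpha>) (nX \<alpha>)"
      using X_ideal[OF \<alpha>] by (simp add: quasi_normed_ideal_space_def)
    then have "nX \<alpha> (l0_add (R \<alpha>) u v) \<le>
        modulus_of_concavity (R \<alpha>) (X \<alpha>) (nX \<alpha>) * (nX \<alpha> u + nX \<alpha> v)"
      using concavity_const_modulus(1) uv by (fastforce simp: concavity_const_def)
    also have "\<dots> \<le> max 1 B * (nX \<alpha> u + nX \<alpha> v)"
      using B[OF \<alpha>] nX_nonneg[OF \<alpha>] uv by (intro mult_right_mono) (auto simp: le_max_iff_disj)
    finally show ?thesis .
  qed
  then show thesis by (intro that[of "max 1 B"]) auto
qed

text \<open>
  The common constant of the pieces can be pulled out of the family as a scalar, which leaves the
  sum of two families to the quasi-triangle inequality of \<open>E\<close>.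
\<close>

lemma koethe_herz_add:
  obtains C where "1 \<le> C"
    "\<And>u v. u \<in> H \<Longrightarrow> v \<in> H \<Longrightarrow> l0_add M u v \<in> H \<and> nH (l0_add M u v) \<le> C * (nH u + nH v)"
proof -
  obtain C where C: "1 \<le> C" "\<And>\<alpha> u v. \<alpha> \<in> I \<Longrightarrow> u \<in> X \<alpha> \<Longrightarrow> v \<in> X \<alpha> \<Longrightarrow>
      nX \<alpha> (l0_add (R \<alpha>) u v) \<le> C * (nX \<alpha> u + nX \<alpha> v)"
    using uniform_concavity by blast
  obtain D where D: "concavity_const (count_space I) E nE D"
    using E_ideal by (auto simp: quasi_normed_ideal_space_def quasi_norm_def)
  have "l0_add M u v \<in> H \<and> nH (l0_add M u v) \<le> (C * D) * (nH u + nH v)"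
    if u: "u \<in> H" and v: "v \<in> H" for u v
  proof -
    let ?p = "piece_norm u" and ?q = "piece_norm v" and ?s = "piece_norm (l0_add M u v)"
    have L0: "u \<in> L0 M" "v \<in> L0 M" and E: "cls ?p \<in> E" "cls ?q \<in> E"
      using u v by (auto simp: mem_H_iff)
    have X: "l0_restrict M (A \<alpha>) u \<in> X \<alpha>" "l0_restrict M (A \<alpha>) v \<in> X \<alpha>" if "\<alpha> \<in> I" for \<alpha>
      using u v that by (auto simp: mem_H_iff)
    have sum_X: "l0_restrict M (A \<alpha>) (l0_add M u v) \<in> X \<alpha>" if "\<alpha> \<in> I" for \<alpha>
      using that X L0 by (simp add: l0_restrict_add A_sets X_add)
    have dom: "\<bar>?s \<alpha>\<bar> \<le> \<bar>C * (?p \<alpha> + ?q \<alpha>)\<bar>" if \<alpha>: "\<alpha> \<in> I" for \<alpha>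
    proof -
      have "\<bar>?s \<alpha>\<bar> = ?s \<alpha>" using nX_nonneg[OF \<alpha> sum_X[OF \<alpha>]] by simp
      also have "\<dots> \<le> C * (?p \<alpha> + ?q \<alpha>)"
        using C(2)[OF \<alpha> X[OF \<alpha>]] L0 \<alpha> by (simp add: l0_restrict_add A_sets)
      finally show ?thesis by linarith
    qed
    have sum_E: "cls (\<lambda>\<alpha>. ?p \<alpha> + ?q \<alpha>) \<in> E" using E by (rule E_add)
    note s = E_dominated[OF E_scale[OF sum_E] dom]
    have "nE (cls ?s) \<le> C * nE (cls (\<lambda>\<alpha>. ?p \<alpha> + ?q \<alpha>))"
      using s(2) nE_scale[OF sum_E, of C] C(1) by simp
    also have "\<dots> \<le> C * (D * (nE (cls ?p) + nE (cls ?q)))"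
      using C(1) D E
      by (intro mult_left_mono)
        (auto simp: concavity_const_def l0_add_class[of ?p "count_space I" ?q, symmetric])
    finally show ?thesis
      using s(1) sum_X L0 by (simp add: mem_H_iff nH_eq L0_add mult.assoc)
  qed
  moreover have "1 \<le> C * D"
    using C(1) D mult_mono[of 1 C 1 D] by (simp add: concavity_const_def)
  ultimately show thesis using that by blast
qed

lemma koethe_herz_scale:
  assumes u: "u \<in> H"
  shows "l0_scale M a u \<in> H" "nH (l0_scale M a u) = \<bar>a\<bar> * nH u"
proof -
  have L0: "u \<in> L0 M" and E: "cls (piece_norm u) \<in> E"
    and X: "\<And>\<alpha>. \<alpha> \<in> I \<Longrightarrow> l0_restrict M (A \<alpha>) u \<in> X \<alpha>"
    using u by (auto simp: mem_H_iff)
  have "cls (piece_norm (l0_scale M a u)) = cls (\<lambda>\<alpha>. \<bar>a\<bar> * piece_norm u \<alpha>)"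
    using L0 X by (simp add: cls_eq_iff l0_restrict_scale A_sets nX_scale)
  then show "l0_scale M a u \<in> H" "nH (l0_scale M a u) = \<bar>a\<bar> * nH u"
    using L0 X E by (simp_all add: mem_H_iff nH_eq L0_scale l0_restrict_scale A_sets X_scale
        E_scale nE_scale)
qed

lemma koethe_herz_zero: "l0_zero M \<in> H"
proof -
  have "cls (piece_norm (l0_zero M)) = cls (\<lambda>\<alpha>. 0)"
    by (simp add: cls_eq_iff l0_restrict_zero A_sets nX_eq_0_iff X_zero)
  then show ?thesis
    by (simp add: mem_H_iff L0_zero l0_restrict_zero A_sets X_zero E_zero)
qed

lemma koethe_herz_norm_eq_0_iff:
  assumes u: "u \<in> H"
  shows "nH u = 0 \<longleftrightarrow> u = l0_zero M"
proof -
  have L0: "u \<in> L0 M" and E: "cls (piece_norm u) \<in> E"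
    and X: "\<And>\<alpha>. \<alpha> \<in> I \<Longrightarrow> l0_restrict M (A \<alpha>) u \<in> X \<alpha>"
    using u by (auto simp: mem_H_iff)
  have "nH u = 0 \<longleftrightarrow> (\<forall>\<alpha>\<in>I. l0_restrict M (A \<alpha>) u = l0_zero (R \<alpha>))"
    using X by (simp add: nH_eq nE_eq_0_iff[OF E] nX_eq_0_iff)
  also have "\<dots> \<longleftrightarrow> u = l0_zero M"
    using eq_zero_if_restrict_zero[OF part L0] by (auto simp: l0_restrict_zero A_sets)
  finally show ?thesis .
qed

lemma koethe_herz_dominated:
  assumes u: "u \<in> L0 M" and v: "v \<in> H" and le: "l0_abs_le M u v"
  shows "u \<in> H \<and> nH u \<le> nH v"
proof -
  have vL0: "v \<in> L0 M" and vE: "cls (piece_norm v) \<in> E"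
    using v by (auto simp: mem_H_iff)
  have u_piece: "l0_restrict M (A \<alpha>) u \<in> X \<alpha> \<and> piece_norm u \<alpha> \<le> piece_norm v \<alpha>"
    if "\<alpha> \<in> I" for \<alpha>
    using that v u vL0 le
    by (intro X_dominated) (auto simp: mem_H_iff l0_restrict_in_L0 l0_restrict_abs_le A_sets)
  have "\<bar>piece_norm u \<alpha>\<bar> \<le> \<bar>piece_norm v \<alpha>\<bar>" if "\<alpha> \<in> I" for \<alpha>
    using u_piece[OF that] nX_nonneg[OF that, of "l0_restrict M (A \<alpha>) u"] by linarith
  from E_dominated[OF vE this] u_piece u show ?thesis
    by (simp add: mem_H_iff nH_eq)
qed

text \<open>
  The normalised family has piecewise norms below \<open>e\<close>, which is what puts the glued
  function into the space; without the normalisation nothing would relate the norms of the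
  \<open>f \<alpha>\<close> to \<open>E\<close>.
\<close>

lemma koethe_herz_positive: "\<exists>u\<in>H. \<exists>f\<in>u. \<forall>x\<in>space M. 0 < f x"
proof -
  obtain e where e: "cls e \<in> E" "\<And>\<alpha>. \<alpha> \<in> I \<Longrightarrow> 0 < e \<alpha>"
  proof -
    obtain u e where u: "u \<in> E" "e \<in> u" "\<forall>\<alpha>\<in>I. 0 < e \<alpha>"
      using E_ideal by (auto simp: quasi_normed_ideal_space_def)
    moreover have "u \<in> L0 (count_space I)"
      using E_ideal u(1) by (auto simp: quasi_normed_ideal_space_def l0_subspace_def)
    ultimately show thesis using L0_memD(2) that by metis
  qed
  have "\<exists>f. f \<in> borel_measurable (R \<alpha>) \<and> l0_class (R \<alpha>) f \<in> X \<alpha> \<and> (\<forall>x\<in>A \<alpha>. 0 < f x)"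
    if \<alpha>: "\<alpha> \<in> I" for \<alpha>
  proof -
    obtain u f where u: "u \<in> X \<alpha>" "f \<in> u" "\<forall>x\<in>space (R \<alpha>). 0 < f x"
      using X_ideal[OF \<alpha>] unfolding quasi_normed_ideal_space_def by blast
    moreover have "space (R \<alpha>) = A \<alpha>"
      using sets.sets_into_space[OF A_sets[OF \<alpha>]] by (auto simp: space_restrict_space)
    ultimately show ?thesis using L0_memD[OF X_L0[OF \<alpha> u(1)] u(2)] by auto
  qed
  then obtain f where f: "\<And>\<alpha>. \<alpha> \<in> I \<Longrightarrow> f \<alpha> \<in> borel_measurable (R \<alpha>)"
    "\<And>\<alpha>. \<alpha> \<in> I \<Longrightarrow> l0_class (R \<alpha>) (f \<alpha>) \<in> X \<alpha>"
    "\<And>\<alpha> x. \<alpha> \<in> I \<Longrightarrow> x \<in> A \<alpha> \<Longrightarrow> 0 < f \<alpha> x"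
    by metis
  \<comment> \<open>Adding \<open>1\<close> keeps the denominator positive even when \<open>A \<alpha>\<close> is a null set,
    where the norm of \<open>f \<alpha>\<close> is \<open>0\<close>.\<close>
  define n where "n = (\<lambda>\<alpha>. nX \<alpha> (l0_class (R \<alpha>) (f \<alpha>)))"
  define c where "c = (\<lambda>\<alpha>. e \<alpha> / (n \<alpha> + 1))"
  have n: "0 \<le> n \<alpha>" if "\<alpha> \<in> I" for \<alpha>
    using nX_nonneg f(2) that by (simp add: n_def)
  have c: "0 < c \<alpha>" if "\<alpha> \<in> I" for \<alpha>
    using n[OF that] e(2)[OF that] by (simp add: c_def)
  obtain w where w: "w \<in> borel_measurable M" "\<And>x. 0 < w x"
    "\<And>\<alpha>. \<alpha> \<in> I \<Longrightarrow> AE x in M. x \<in> A \<alpha> \<longrightarrow> w x = c \<alpha> * f \<alpha> x"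
  proof (rule measurable_gluing[OF part, of "\<lambda>\<alpha> x. c \<alpha> * f \<alpha> x"])
    show "(\<lambda>x. c \<alpha> * f \<alpha> x) \<in> borel_measurable (R \<alpha>)" if "\<alpha> \<in> I" for \<alpha>
      using f(1)[OF that] by simp
    show "0 < c \<alpha> * f \<alpha> x" if "\<alpha> \<in> I" "x \<in> A \<alpha>" for \<alpha> x
      using c f(3) that by simp
  qed blast
  have w_restrict: "l0_restrict M (A \<alpha>) (l0_class M w) =
      l0_scale (R \<alpha>) (c \<alpha>) (l0_class (R \<alpha>) (f \<alpha>))" if \<alpha>: "\<alpha> \<in> I" for \<alpha>
  proof -
    have "AE x in R \<alpha>. w x * indicator (A \<alpha>) x = c \<alpha> * f \<alpha> x"
      using w(3)[OF \<alpha>] A_sets[OF \<alpha>] by (subst AE_restrict_space_iff) auto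
    then show ?thesis
      using f(1)[OF \<alpha>] w(1) A_sets[OF \<alpha>]
      by (simp add: l0_restrict_class l0_scale_class l0_class_eq_iff
          borel_measurable_restrict_indicator)
  qed
  have w_norm: "\<bar>piece_norm (l0_class M w) \<alpha>\<bar> \<le> \<bar>e \<alpha>\<bar>" if \<alpha>: "\<alpha> \<in> I" for \<alpha>
  proof -
    have "piece_norm (l0_class M w) \<alpha> = c \<alpha> * n \<alpha>"
      using c[OF \<alpha>] \<alpha> f(2) by (simp add: w_restrict nX_scale n_def)
    moreover have "c \<alpha> * n \<alpha> \<le> e \<alpha>"
      using n[OF \<alpha>] e(2)[OF \<alpha>] by (simp add: c_def field_simps)
    ultimately show ?thesis
      using n[OF \<alpha>] c[OF \<alpha>] by simp
  qed
  have "l0_class M w \<in> H"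
    using w(1) f(2) E_dominated(1)[OF e(1) w_norm]
    by (simp add: mem_H_iff l0_class_in_L0 w_restrict X_scale)
  moreover have "w \<in> l0_class M w"
    using w(1) by (simp add: mem_l0_class_iff)
  ultimately show ?thesis using w(2) by blast
qed

lemma koethe_herz_ideal_space: "quasi_normed_ideal_space M H nH"
proof -
  obtain C where C: "1 \<le> C"
    "\<And>u v. u \<in> H \<Longrightarrow> v \<in> H \<Longrightarrow> l0_add M u v \<in> H \<and> nH (l0_add M u v) \<le> C * (nH u + nH v)"
    using koethe_herz_add by blast
  have "l0_subspace M H"
    using C(2) koethe_herz_zero koethe_herz_scale(1)
    by (auto simp: l0_subspace_def mem_H_iff[THEN iffD1])
  moreover have "concavity_const M H nH C"
    using C by (simp add: concavity_const_def)
  then have "quasi_norm M H nH"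
    using koethe_herz_norm_eq_0_iff koethe_herz_scale(2)
    by (auto simp: quasi_norm_def nH_eq mem_H_iff intro: nE_nonneg)
  ultimately show ?thesis
    using koethe_herz_dominated koethe_herz_positive
    by (simp add: quasi_normed_ideal_space_def)
qed

end

theorem proposition3p6:
  fixes M :: "'a measure"
    and I :: "'i set"
    and A :: "'i \<Rightarrow> 'a set"
    and X :: "'i \<Rightarrow> 'a l0 set"
    and nX :: "'i \<Rightarrow> 'a l0 \<Rightarrow> real"
    and E :: "'i l0 set"
    and nE :: "'i l0 \<Rightarrow> real"
  assumes "sigma_finite_measure M"
    and "complete_measure M"
    and "countable_measurable_partition M I A"
    and "\<And>\<alpha>. \<alpha> \<in> I \<Longrightarrow> quasi_normed_ideal_space (restrict_space M (A \<alpha>)) (X \<alpha>) (nX \<alpha>)"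
    and "\<And>\<alpha>. \<alpha> \<in> I \<Longrightarrow> X \<alpha> \<noteq> {l0_zero (restrict_space M (A \<alpha>))}"
    and "bdd_above ((\<lambda>\<alpha>. modulus_of_concavity (restrict_space M (A \<alpha>)) (X \<alpha>) (nX \<alpha>)) ` I)"
    and "quasi_normed_ideal_space (count_space I) E nE"
  shows "quasi_normed_ideal_space M (koethe_herz_space M I A E X nX) (koethe_herz_norm M I A nE nX)"
proof -
  interpret koethe_herz M I A X nX E nE
    using assms by unfold_locales
  show ?thesis by (rule koethe_herz_ideal_space)
qed

end
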